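(* Let $X$ be the real vector space of all sequences $\{a_n\}_{n=1}^\infty\subseteq\mathbb{R}$ with finite support (i.e. $\#\{k:a_k\neq 0\}<\infty$), and define $$d(\{a_n\}_{n=1}^\infty,\{b_n\}_{n=1}^\infty)=\sum_{n=1}^\infty \Phi_n(a_n-b_n),$$ where, for $k\ge 1$ and $t\in\mathbb{R}$, $$\Phi_k(t)=\begin{cases} k|t| & \text{if } |t|\le \frac1k,\\ 1+|t|-\frac1k & \text{otherwise.}\end{cases}$$ Then $(X,d)$ is a metric topological vector space which does not have the corona property. Consequently, its metric completion $(\widetilde{X},d)$ is a complete metric topological vector space which does not have the corona property.
   Context: A metric topological vector space is a vector space with a metric $d$ such that vector addition and scalar multiplication are continuous for the topology induced by $d$. The metric completion $\widetilde{X}$ is given the vector space operations obtained by continuous extension from $X$, and the extended metric is still denoted $d$. For a metric space $(X,d)$, $\overline{B}(x,t)=\{y\in X: d(x,y)\le t\}$ denotes the closed ball with center $x$ and radius $t$, and $d(y,A)=\inf_{a\in A}d(y,a)$ for nonempty $A\subset X$. $(X,d)$ has the corona property if there exists a constant $C>0$ such that for every $t>0$ there is $\varepsilon_0(t)>0$ such that for all $x,y\in X$ and all $\varepsilon\in[0,\varepsilon_0(t))$, the relation $d(x,y)\le t+\varepsilon$ implies $d(y,\overline{B}(x,t))\le C\varepsilon$. *)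

theory Defs
  imports "HOL-Analysis.Analysis" "HOL-Algebra.Module"
begin

section \<open>Metric topological vector spaces and the corona property\<close>

text \<open>Real vector spaces with an explicit carrier are modules over the field of real numbers.
  The ring multiplication and unit that the record type of modules inherits play no role.\<close>

definition real_ring :: "real ring" where
  "real_ring = \<lparr>carrier = UNIV, monoid.mult = (*), one = 1, zero = 0, add = (+)\<rparr>"

definition metric_tvs :: "(real, 'a) module \<Rightarrow> ('a \<Rightarrow> 'a \<Rightarrow> real) \<Rightarrow> bool" where
  "metric_tvs V d \<longleftrightarrow>
     module real_ring V \<and>
     Metric_space (carrier V) d \<and>
     (let T = Metric_space.mtopology (carrier V) d in
        continuous_map (prod_topology T T) T (\<lambda>(x, y). x \<oplus>\<^bsub>V\<^esub> y) \<and>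
        continuous_map (prod_topology euclideanreal T) T (\<lambda>(c, x). c \<odot>\<^bsub>V\<^esub> x))"

definition dist_to_set :: "('a \<Rightarrow> 'a \<Rightarrow> real) \<Rightarrow> 'a \<Rightarrow> 'a set \<Rightarrow> real" where
  "dist_to_set d y A = (INF a\<in>A. d y a)"

definition corona_property :: "'a set \<Rightarrow> ('a \<Rightarrow> 'a \<Rightarrow> real) \<Rightarrow> bool" where
  "corona_property M d \<longleftrightarrow>
     (\<exists>C>0. \<forall>t>0. \<exists>\<epsilon>\<^sub>0>0. \<forall>x\<in>M. \<forall>y\<in>M. \<forall>\<epsilon>. 0 \<le> \<epsilon> \<and> \<epsilon> < \<epsilon>\<^sub>0 \<longrightarrow>
        d x y \<le> t + \<epsilon> \<longrightarrow> dist_to_set d y (Metric_space.mcball M d x t) \<le> C * \<epsilon>)"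

section \<open>The metric completion\<close>

text \<open>Points of the completion are the classes of Cauchy sequences modulo
  \<open>d (\<sigma> n) (\<tau> n) \<longlonglongrightarrow> 0\<close>.\<close>

definition cauchy_rel :: "'a set \<Rightarrow> ('a \<Rightarrow> 'a \<Rightarrow> real) \<Rightarrow> ((nat \<Rightarrow> 'a) \<times> (nat \<Rightarrow> 'a)) set" where
  "cauchy_rel M d = {(\<sigma>, \<tau>). Metric_space.MCauchy M d \<sigma> \<and> Metric_space.MCauchy M d \<tau> \<and>
     (\<lambda>n. d (\<sigma> n) (\<tau> n)) \<longlonglongrightarrow> 0}"

definition completion_carrier :: "'a set \<Rightarrow> ('a \<Rightarrow> 'a \<Rightarrow> real) \<Rightarrow> (nat \<Rightarrow> 'a) set set" where
  "completion_carrier M d = {\<sigma>. Metric_space.MCauchy M d \<sigma>} // cauchy_rel M d"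

text \<open>The value 0 off the carrier only serves the locale \<^locale>\<open>Metric_space\<close>, which asks for
  nonnegativity and symmetry on the whole type.\<close>

definition completion_dist ::
    "'a set \<Rightarrow> ('a \<Rightarrow> 'a \<Rightarrow> real) \<Rightarrow> (nat \<Rightarrow> 'a) set \<Rightarrow> (nat \<Rightarrow> 'a) set \<Rightarrow> real" where
  "completion_dist M d P Q =
     (if P \<in> completion_carrier M d \<and> Q \<in> completion_carrier M d
      then THE r. \<forall>\<sigma>\<in>P. \<forall>\<tau>\<in>Q. (\<lambda>n. d (\<sigma> n) (\<tau> n)) \<longlonglongrightarrow> r
      else 0)"

definition completion_embed :: "'a set \<Rightarrow> ('a \<Rightarrow> 'a \<Rightarrow> real) \<Rightarrow> 'a \<Rightarrow> (nat \<Rightarrow> 'a) set" where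
  "completion_embed M d x = cauchy_rel M d `` {\<lambda>_. x}"

definition completion_topology :: "'a set \<Rightarrow> ('a \<Rightarrow> 'a \<Rightarrow> real) \<Rightarrow> (nat \<Rightarrow> 'a) set topology" where
  "completion_topology M d =
     Metric_space.mtopology (completion_carrier M d) (completion_dist M d)"

text \<open>The continuous map \<open>f\<close> from \<open>S\<close> to \<open>T\<close> with \<open>f (j a) = g a\<close> for all \<open>a \<in> A\<close>, that is, the
  continuous extension of \<open>g\<close> along \<open>j\<close>. It is unique when \<open>j ` A\<close> is dense in \<open>S\<close> and \<open>T\<close> is
  Hausdorff; \<^const>\<open>extensional\<close> pins down the irrelevant values off the space.\<close>

definition continuous_extension ::
    "'b topology \<Rightarrow> 'c topology \<Rightarrow> 'a set \<Rightarrow> ('a \<Rightarrow> 'b) \<Rightarrow> ('a \<Rightarrow> 'c) \<Rightarrow> 'b \<Rightarrow> 'c" where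
  "continuous_extension S T A j g =
     (THE f. f \<in> extensional (topspace S) \<and> continuous_map S T f \<and> (\<forall>a\<in>A. f (j a) = g a))"

definition completion_space ::
    "(real, 'a) module \<Rightarrow> ('a \<Rightarrow> 'a \<Rightarrow> real) \<Rightarrow> (real, (nat \<Rightarrow> 'a) set) module" where
  "completion_space V d =
     (let X = carrier V; T = completion_topology X d; \<iota> = completion_embed X d in
      \<lparr>carrier = completion_carrier X d,
       monoid.mult = undefined,
       one = undefined,
       zero = \<iota> \<zero>\<^bsub>V\<^esub>,
       add = (\<lambda>P Q. continuous_extension (prod_topology T T) T (X \<times> X)
                (\<lambda>(x, y). (\<iota> x, \<iota> y)) (\<lambda>(x, y). \<iota> (x \<oplus>\<^bsub>V\<^esub> y)) (P, Q)),
       smult = (\<lambda>c P. continuous_extension (prod_topology euclideanreal T) T (UNIV \<times> X)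
                (\<lambda>(c, x). (c, \<iota> x)) (\<lambda>(c, x). \<iota> (c \<odot>\<^bsub>V\<^esub> x)) (c, P))\<rparr>)"

section \<open>Finitely supported sequences\<close>

text \<open>A sequence \<open>(a\<^sub>n)\<close> with \<open>n \<ge> 1\<close> is a function \<open>a :: nat \<Rightarrow> real\<close> whose value at \<open>n\<close> is the
  entry with index \<open>n + 1\<close>.\<close>

definition fin_seq :: "(real, nat \<Rightarrow> real) module" where
  "fin_seq =
     \<lparr>carrier = {a. finite {n. a n \<noteq> 0}},
      monoid.mult = undefined,
      one = undefined,
      zero = (\<lambda>n. 0),
      add = (\<lambda>a b n. a n + b n),
      smult = (\<lambda>c a n. c * a n)\<rparr>"

definition Phi :: "nat \<Rightarrow> real \<Rightarrow> real" where
  "Phi k t = (if \<bar>t\<bar> \<le> 1 / real k then real k * \<bar>t\<bar> else 1 + \<bar>t\<bar> - 1 / real k)"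

text \<open>On \<^const>\<open>fin_seq\<close> only finitely many terms are nonzero. Off it, \<^const>\<open>infsum\<close> still gives
  a nonnegative value, as \<^locale>\<open>Metric_space\<close> requires.\<close>

definition fin_seq_dist :: "(nat \<Rightarrow> real) \<Rightarrow> (nat \<Rightarrow> real) \<Rightarrow> real" where
  "fin_seq_dist a b = (\<Sum>\<^sub>\<infinity>n. Phi (Suc n) (a n - b n))"

end

theory Submission
  imports Defs
begin

text \<open>Since \<open>Phi k t = \<bar>t\<bar> + (k - 1) * min \<bar>t\<bar> (1 / k)\<close>, the distance is translation invariant and
  multiplication by \<open>c\<close> is Lipschitz with constant \<open>max 1 \<bar>c\<bar>\<close>. These estimates give
  continuity of the operations and pass to classes of Cauchy sequences, where the
  operations are computed termwise.

  The slope of \<open>Phi k\<close> drops from \<open>k\<close> to \<open>1\<close> at the point \<open>1 / k\<close>, where its value is \<open>1\<close>. So the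
  multiple \<open>1 / k + \<epsilon>\<close> of the \<open>k\<close>-th unit vector has distance \<open>1 + \<epsilon>\<close> from the
  origin, but distance at least \<open>k * \<epsilon>\<close> from the unit ball, whose elements have \<open>k\<close>-th entry at
  most \<open>1 / k\<close>.\<close>

section \<open>Completion of a metric space\<close>

context Metric_space
begin

abbreviation cauchy_class :: "(nat \<Rightarrow> 'a) \<Rightarrow> (nat \<Rightarrow> 'a) set" where
  "cauchy_class \<sigma> \<equiv> cauchy_rel M d `` {\<sigma>}"

abbreviation completion :: "(nat \<Rightarrow> 'a) set set" where
  "completion \<equiv> completion_carrier M d"

abbreviation cdist :: "(nat \<Rightarrow> 'a) set \<Rightarrow> (nat \<Rightarrow> 'a) set \<Rightarrow> real" where
  "cdist \<equiv> completion_dist M d"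

section \<open>Cauchy sequences and the limits of their distances\<close>

lemma MCauchy_in_space: "MCauchy \<sigma> \<Longrightarrow> \<sigma> n \<in> M"
  by (auto simp: MCauchy_def)

lemma MCauchyI:
  assumes "\<And>n. \<sigma> n \<in> M"
    and "\<And>\<epsilon>. \<epsilon> > 0 \<Longrightarrow> \<exists>N. \<forall>m\<ge>N. \<forall>n\<ge>N. d (\<sigma> m) (\<sigma> n) < \<epsilon>"
  shows "MCauchy \<sigma>"
  using assms unfolding MCauchy_def by blast

lemma MCauchyE:
  assumes "MCauchy \<sigma>" "\<epsilon> > 0"
  obtains N where "\<And>m n. m \<ge> N \<Longrightarrow> n \<ge> N \<Longrightarrow> d (\<sigma> m) (\<sigma> n) < \<epsilon>"
  using assms unfolding MCauchy_def by blast

text \<open>Two applications of the triangle inequality in each direction. This quadrilateral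
  estimate is the quantitative continuity of the metric behind the limits of distances
  below.\<close>

lemma dist_diff_le:
  assumes "x \<in> M" "y \<in> M" "x' \<in> M" "y' \<in> M"
  shows "\<bar>d x y - d x' y'\<bar> \<le> d x x' + d y y'"
proof -
  have "d x y \<le> d x x' + d x' y' + d y' y"
    using assms triangle[of x x' y] triangle[of x' y' y] by auto
  moreover have "d x' y' \<le> d x' x + d x y + d y y'"
    using assms triangle[of x' x y'] triangle[of x y y'] by auto
  ultimately show ?thesis
    using commute[of x x'] commute[of y y'] by linarith
qed

text \<open>By \<open>dist_diff_le\<close> the real sequence of distances is itself Cauchy, and the
  reals are complete.\<close>

lemma convergent_dist_MCauchy:
  assumes \<sigma>: "MCauchy \<sigma>" and \<tau>: "MCauchy \<tau>"
  shows "convergent (\<lambda>n. d (\<sigma> n) (\<tau> n))"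
proof -
  have "Cauchy (\<lambda>n. d (\<sigma> n) (\<tau> n))"
  proof (rule metric_CauchyI)
    fix e :: real assume "e > 0"
    then have e: "e/2 > 0" by simp
    obtain N1 where N1: "\<And>m n. m \<ge> N1 \<Longrightarrow> n \<ge> N1 \<Longrightarrow> d (\<sigma> m) (\<sigma> n) < e/2"
      using MCauchyE[OF \<sigma> e] by blast
    obtain N2 where N2: "\<And>m n. m \<ge> N2 \<Longrightarrow> n \<ge> N2 \<Longrightarrow> d (\<tau> m) (\<tau> n) < e/2"
      using MCauchyE[OF \<tau> e] by blast
    have "dist (d (\<sigma> m) (\<tau> m)) (d (\<sigma> n) (\<tau> n)) < e" if "m \<ge> max N1 N2" "n \<ge> max N1 N2" for m n
      using dist_diff_le[of "\<sigma> m" "\<tau> m" "\<sigma> n" "\<tau> n"] N1[of m n] N2[of m n] that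
        MCauchy_in_space[OF \<sigma>] MCauchy_in_space[OF \<tau>] by (simp add: dist_real_def)
    then show "\<exists>N. \<forall>m\<ge>N. \<forall>n\<ge>N. dist (d (\<sigma> m) (\<tau> m)) (d (\<sigma> n) (\<tau> n)) < e" by blast
  qed
  then show ?thesis by (rule Cauchy_convergent)
qed

text \<open>The two distance sequences differ by a null sequence, by \<open>dist_diff_le\<close>.
  The lemma serves twice: for the transitivity of \<open>cauchy_rel\<close>, and for the
  independence of \<open>completion_dist\<close> from representatives.\<close>

lemma tendsto_dist_trans:
  assumes M: "\<And>n. \<sigma> n \<in> M" "\<And>n. \<sigma>' n \<in> M" "\<And>n. \<tau> n \<in> M" "\<And>n. \<tau>' n \<in> M"
    and \<sigma>: "(\<lambda>n. d (\<sigma> n) (\<sigma>' n)) \<longlonglongrightarrow> 0" and \<tau>: "(\<lambda>n. d (\<tau> n) (\<tau>' n)) \<longlonglongrightarrow> 0"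
    and r: "(\<lambda>n. d (\<sigma> n) (\<tau> n)) \<longlonglongrightarrow> r"
  shows "(\<lambda>n. d (\<sigma>' n) (\<tau>' n)) \<longlonglongrightarrow> r"
proof -
  have "(\<lambda>n. d (\<sigma> n) (\<tau> n) - d (\<sigma>' n) (\<tau>' n)) \<longlonglongrightarrow> 0"
  proof (rule Lim_null_comparison)
    show "\<forall>\<^sub>F n in sequentially. norm (d (\<sigma> n) (\<tau> n) - d (\<sigma>' n) (\<tau>' n))
        \<le> d (\<sigma> n) (\<sigma>' n) + d (\<tau> n) (\<tau>' n)"
      using M by (simp add: dist_diff_le)
    show "(\<lambda>n. d (\<sigma> n) (\<sigma>' n) + d (\<tau> n) (\<tau>' n)) \<longlonglongrightarrow> 0"
      using tendsto_add[OF \<sigma> \<tau>] by simp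
  qed
  from tendsto_diff[OF r this] show ?thesis by simp
qed

lemma equiv_cauchy_rel: "equiv {\<sigma>. MCauchy \<sigma>} (cauchy_rel M d)"
proof (rule equivI)
  show "cauchy_rel M d \<subseteq> {\<sigma>. MCauchy \<sigma>} \<times> {\<sigma>. MCauchy \<sigma>}"
    by (auto simp: cauchy_rel_def)
  show "refl_on {\<sigma>. MCauchy \<sigma>} (cauchy_rel M d)"
    by (auto simp: refl_on_def cauchy_rel_def MCauchy_in_space)
  show "sym (cauchy_rel M d)"
    by (auto simp: sym_def cauchy_rel_def commute)
  show "trans (cauchy_rel M d)"
  proof (rule transI)
    fix \<rho> \<sigma> \<tau> assume "(\<rho>, \<sigma>) \<in> cauchy_rel M d" "(\<sigma>, \<tau>) \<in> cauchy_rel M d"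
    then have *: "MCauchy \<rho>" "MCauchy \<sigma>" "MCauchy \<tau>" "(\<lambda>n. d (\<sigma> n) (\<rho> n)) \<longlonglongrightarrow> 0"
        "(\<lambda>n. d (\<sigma> n) (\<tau> n)) \<longlonglongrightarrow> 0"
      by (auto simp: cauchy_rel_def commute)
    \<comment> \<open>Start from the pair \<open>\<sigma>\<close>, \<open>\<sigma>\<close> at
      distance 0 and move its entries to \<open>\<rho>\<close> and \<open>\<tau>\<close>; for this
      the first of the two null sequences was stored with its arguments swapped.\<close>
    have "(\<lambda>n. d (\<rho> n) (\<tau> n)) \<longlonglongrightarrow> 0"
      by (rule tendsto_dist_trans[OF _ _ _ _ *(4,5)]) (use * in \<open>auto simp: MCauchy_in_space\<close>)
    with * show "(\<rho>, \<tau>) \<in> cauchy_rel M d" by (simp add: cauchy_rel_def)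
  qed
qed

section \<open>Classes of Cauchy sequences and the distance between them\<close>

lemma cauchy_class_in_completion: "MCauchy \<sigma> \<Longrightarrow> cauchy_class \<sigma> \<in> completion"
  unfolding completion_carrier_def by (rule quotientI) simp

lemma completionE:
  assumes "P \<in> completion"
  obtains \<sigma> where "MCauchy \<sigma>" "P = cauchy_class \<sigma>"
  using assms unfolding completion_carrier_def by (auto elim: quotientE)

lemma cauchy_class_eq_iff:
  assumes "MCauchy \<sigma>" "MCauchy \<tau>"
  shows "cauchy_class \<sigma> = cauchy_class \<tau> \<longleftrightarrow> (\<lambda>n. d (\<sigma> n) (\<tau> n)) \<longlonglongrightarrow> 0"
  using eq_equiv_class_iff[OF equiv_cauchy_rel, of \<sigma> \<tau>] assms by (simp add: cauchy_rel_def)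

text \<open>All pairs of representatives share one limit by \<open>tendsto_dist_trans\<close>, so
  the definite description in \<open>completion_dist\<close> denotes it. Estimates between points of
  the completion then become limits of estimates for \<open>d\<close>.\<close>

lemma tendsto_completion_dist:
  assumes "MCauchy \<sigma>" "MCauchy \<tau>"
  shows "(\<lambda>n. d (\<sigma> n) (\<tau> n)) \<longlonglongrightarrow> cdist (cauchy_class \<sigma>) (cauchy_class \<tau>)"
proof -
  obtain r where r: "(\<lambda>n. d (\<sigma> n) (\<tau> n)) \<longlonglongrightarrow> r"
    using convergent_dist_MCauchy[OF assms] by (auto simp: convergent_def)
  have all: "(\<lambda>n. d (\<sigma>' n) (\<tau>' n)) \<longlonglongrightarrow> r" if "\<sigma>' \<in> cauchy_class \<sigma>" "\<tau>' \<in> cauchy_class \<tau>" for \<sigma>' \<tau>'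
    by (rule tendsto_dist_trans[OF _ _ _ _ _ _ r])
      (use that assms in \<open>auto simp: cauchy_rel_def MCauchy_in_space\<close>)
  have self: "\<sigma> \<in> cauchy_class \<sigma>" "\<tau> \<in> cauchy_class \<tau>"
    using assms equiv_class_self[OF equiv_cauchy_rel] by auto
  have "(THE s. \<forall>\<sigma>'\<in>cauchy_class \<sigma>. \<forall>\<tau>'\<in>cauchy_class \<tau>. (\<lambda>n. d (\<sigma>' n) (\<tau>' n)) \<longlonglongrightarrow> s) = r"
    using all self r LIMSEQ_unique by (intro the_equality) blast+
  then have "cdist (cauchy_class \<sigma>) (cauchy_class \<tau>) = r"
    using assms by (simp add: completion_dist_def cauchy_class_in_completion)
  with r show ?thesis by simp
qed

lemma completion_dist_eqI:
  "\<lbrakk>MCauchy \<sigma>; MCauchy \<tau>; (\<lambda>n. d (\<sigma> n) (\<tau> n)) \<longlonglongrightarrow> r\<rbrakk>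
    \<Longrightarrow> cdist (cauchy_class \<sigma>) (cauchy_class \<tau>) = r"
  using LIMSEQ_unique tendsto_completion_dist by blast

text \<open>Nonnegativity, symmetry and the triangle inequality pass to the limit, and distance 0
  means equality by the very construction of the classes. Off the completion the default value 0
  provides nonnegativity and symmetry.\<close>

lemma Metric_space_completion: "Metric_space completion cdist"
proof
  fix P Q
  show "0 \<le> cdist P Q"
  proof (cases "P \<in> completion \<and> Q \<in> completion")
    case True
    then obtain \<sigma> \<tau> where *: "MCauchy \<sigma>" "P = cauchy_class \<sigma>" "MCauchy \<tau>" "Q = cauchy_class \<tau>"
      by (meson completionE)
    then show ?thesis
      using tendsto_completion_dist[OF *(1,3)] by (intro LIMSEQ_le_const) auto
  qed (auto simp: completion_dist_def)
  show "cdist P Q = cdist Q P"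
  proof (cases "P \<in> completion \<and> Q \<in> completion")
    case True
    then obtain \<sigma> \<tau> where *: "MCauchy \<sigma>" "P = cauchy_class \<sigma>" "MCauchy \<tau>" "Q = cauchy_class \<tau>"
      by (meson completionE)
    have "(\<lambda>n. d (\<sigma> n) (\<tau> n)) \<longlonglongrightarrow> cdist Q P"
      unfolding *(2,4) by (subst commute) (rule tendsto_completion_dist[OF *(3,1)])
    from completion_dist_eqI[OF *(1,3) this] show ?thesis unfolding *(2,4) .
  qed (auto simp: completion_dist_def)
next
  fix P Q assume "P \<in> completion" "Q \<in> completion"
  then obtain \<sigma> \<tau> where *: "MCauchy \<sigma>" "P = cauchy_class \<sigma>" "MCauchy \<tau>" "Q = cauchy_class \<tau>"
    by (meson completionE)
  show "cdist P Q = 0 \<longleftrightarrow> P = Q"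
    unfolding *(2,4) cauchy_class_eq_iff[OF *(1,3)]
    using tendsto_completion_dist[OF *(1,3)] completion_dist_eqI[OF *(1,3)] by metis
next
  fix P Q R assume "P \<in> completion" "Q \<in> completion" "R \<in> completion"
  then obtain \<rho> \<sigma> \<tau> where *: "MCauchy \<rho>" "P = cauchy_class \<rho>" "MCauchy \<sigma>" "Q = cauchy_class \<sigma>"
      "MCauchy \<tau>" "R = cauchy_class \<tau>"
    by (meson completionE)
  have "cdist P R \<le> cdist P Q + cdist Q R" unfolding *(2,4,6)
    by (rule LIMSEQ_le[OF tendsto_completion_dist tendsto_add[OF tendsto_completion_dist tendsto_completion_dist]])
      (use * in \<open>auto intro!: triangle MCauchy_in_space\<close>)
  then show "cdist P R \<le> cdist P Q + cdist Q R" .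
qed

interpretation C: Metric_space completion cdist
  by (rule Metric_space_completion)

section \<open>The dense isometric embedding and completeness\<close>

lemma completion_embed_in: "x \<in> M \<Longrightarrow> completion_embed M d x \<in> completion"
  unfolding completion_embed_def by (rule cauchy_class_in_completion) simp

lemma completion_dist_embed:
  "\<lbrakk>x \<in> M; y \<in> M\<rbrakk> \<Longrightarrow> cdist (completion_embed M d x) (completion_embed M d y) = d x y"
  unfolding completion_embed_def by (rule completion_dist_eqI) auto

lemma tendsto_dist_embed:
  assumes "MCauchy \<sigma>" "x \<in> M"
  shows "(\<lambda>n. d x (\<sigma> n)) \<longlonglongrightarrow> cdist (completion_embed M d x) (cauchy_class \<sigma>)"
  unfolding completion_embed_def using assms tendsto_completion_dist[of "\<lambda>_. x" \<sigma>] by simp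

text \<open>With \<open>n\<close> fixed, the tail estimate
  \<open>d (\<sigma> n) (\<sigma> m) < e/2\<close> passes to the limit in \<open>m\<close>, where it
  survives only as a weak inequality; hence the half.\<close>

lemma MCauchy_close_to_class:
  assumes "MCauchy \<sigma>" "e > 0"
  shows "\<exists>N. \<forall>n\<ge>N. cdist (completion_embed M d (\<sigma> n)) (cauchy_class \<sigma>) < e"
proof -
  obtain N where N: "\<And>m n. m \<ge> N \<Longrightarrow> n \<ge> N \<Longrightarrow> d (\<sigma> m) (\<sigma> n) < e/2"
    using MCauchyE[OF assms(1), of "e/2"] assms(2) by auto
  have "cdist (completion_embed M d (\<sigma> n)) (cauchy_class \<sigma>) \<le> e/2" if "n \<ge> N" for n
    using N that assms MCauchy_in_space
    by (intro LIMSEQ_le_const2[OF tendsto_dist_embed]) (auto intro: less_imp_le)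
  then show ?thesis using assms(2) by (intro exI[of _ N]) (smt (verit) field_sum_of_halves)
qed

lemma completion_approx:
  assumes "P \<in> completion" "e > 0"
  obtains x where "x \<in> M" "cdist (completion_embed M d x) P < e"
proof -
  obtain \<sigma> where \<sigma>: "MCauchy \<sigma>" "P = cauchy_class \<sigma>"
    using assms(1) by (rule completionE)
  then obtain N where "cdist (completion_embed M d (\<sigma> N)) P < e"
    using MCauchy_close_to_class[OF \<sigma>(1) assms(2)] by blast
  then show thesis using that MCauchy_in_space[OF \<sigma>(1)] by blast
qed

lemma dense_completion_embed: "C.mtopology closure_of (completion_embed M d ` M) = completion"
proof -
  have "\<exists>y\<in>completion_embed M d ` M. y \<in> C.mball P r" if "P \<in> completion" "r > 0" for P r
    using completion_approx[OF that] that completion_embed_in C.commute by (metis C.in_mball imageI)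
  then show ?thesis unfolding C.metric_closure_of by blast
qed

text \<open>Diagonal argument: pick \<open>x n\<close> in \<open>M\<close> whose image is within
  \<open>1/(n+1)\<close> of \<open>\<Sigma> n\<close>. The sequence \<open>x\<close> inherits the
  Cauchy property from \<open>\<Sigma>\<close>, and its class is the limit, because the images of
  \<open>x n\<close> are eventually close both to \<open>\<Sigma> n\<close> and to that
  class.\<close>

lemma mcomplete_completion: "C.mcomplete"
  unfolding C.mcomplete_def
proof (intro allI impI)
  fix \<Sigma> assume \<Sigma>: "C.MCauchy \<Sigma>"
  have "\<exists>x. x \<in> M \<and> cdist (completion_embed M d x) (\<Sigma> n) < inverse (real (Suc n))" for n
    by (rule completion_approx[OF C.MCauchy_in_space[OF \<Sigma>], of "inverse (real (Suc n))" n]) auto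
  then obtain x where x: "\<And>n. x n \<in> M"
      and close: "\<And>n. cdist (completion_embed M d (x n)) (\<Sigma> n) < inverse (real (Suc n))"
    by metis
  have small: "\<exists>N. \<forall>n\<ge>N. cdist (completion_embed M d (x n)) (\<Sigma> n) < e" if "e > 0" for e
  proof -
    obtain N where "inverse (real (Suc N)) < e" using reals_Archimedean[OF \<open>e > 0\<close>] by auto
    moreover have "inverse (real (Suc n)) \<le> inverse (real (Suc N))" if "n \<ge> N" for n
      using that by (simp add: field_simps)
    ultimately show ?thesis using close by (meson less_le_trans less_trans order_trans le_less_trans)
  qed
  have x_Cauchy: "MCauchy x"
  proof (rule MCauchyI[OF x])
    fix e :: real assume "e > 0"
    then have e: "e/3 > 0" by simp
    obtain N1 where N1: "\<And>n. n \<ge> N1 \<Longrightarrow> cdist (completion_embed M d (x n)) (\<Sigma> n) < e/3"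
      using small[OF e] by blast
    obtain N2 where N2: "\<And>m n. m \<ge> N2 \<Longrightarrow> n \<ge> N2 \<Longrightarrow> cdist (\<Sigma> m) (\<Sigma> n) < e/3"
      using C.MCauchyE[OF \<Sigma> e] by blast
    have "d (x m) (x n) < e" if "m \<ge> max N1 N2" "n \<ge> max N1 N2" for m n
    proof -
      have "\<bar>cdist (completion_embed M d (x m)) (completion_embed M d (x n)) - cdist (\<Sigma> m) (\<Sigma> n)\<bar>
          \<le> cdist (completion_embed M d (x m)) (\<Sigma> m) + cdist (completion_embed M d (x n)) (\<Sigma> n)"
        by (intro C.dist_diff_le completion_embed_in x C.MCauchy_in_space[OF \<Sigma>])
      then show ?thesis
        using N1[of m] N1[of n] N2[of m n] that by (simp add: completion_dist_embed x)
    qed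
    then show "\<exists>N. \<forall>m\<ge>N. \<forall>n\<ge>N. d (x m) (x n) < e" by blast
  qed
  have "limitin C.mtopology \<Sigma> (cauchy_class x) sequentially"
    unfolding C.limit_metric_sequentially
  proof (intro conjI allI impI)
    show "cauchy_class x \<in> completion" by (rule cauchy_class_in_completion[OF x_Cauchy])
    fix e :: real assume "e > 0"
    then have e: "e/2 > 0" by simp
    obtain N1 where N1: "\<And>n. n \<ge> N1 \<Longrightarrow> cdist (completion_embed M d (x n)) (\<Sigma> n) < e/2"
      using small[OF e] by blast
    obtain N2 where N2: "\<And>n. n \<ge> N2 \<Longrightarrow> cdist (completion_embed M d (x n)) (cauchy_class x) < e/2"
      using MCauchy_close_to_class[OF x_Cauchy e] by blast
    have "\<Sigma> n \<in> completion \<and> cdist (\<Sigma> n) (cauchy_class x) < e" if "n \<ge> max N1 N2" for n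
      using C.triangle''[of "\<Sigma> n" "completion_embed M d (x n)" "cauchy_class x"] N1[of n] N2[of n] that
        C.MCauchy_in_space[OF \<Sigma>] completion_embed_in[OF x] cauchy_class_in_completion[OF x_Cauchy]
      by force
    then show "\<exists>N. \<forall>n\<ge>N. \<Sigma> n \<in> completion \<and> cdist (\<Sigma> n) (cauchy_class x) < e" by blast
  qed
  then show "\<exists>l. limitin C.mtopology \<Sigma> l sequentially" by blast
qed

section \<open>Metric criteria for continuity of the vector space operations\<close>

lemma continuous_map_dist_sum_bound:
  assumes closed: "\<And>x y. \<lbrakk>x \<in> M; y \<in> M\<rbrakk> \<Longrightarrow> f x y \<in> M"
    and le: "\<And>x y x' y'. \<lbrakk>x \<in> M; y \<in> M; x' \<in> M; y' \<in> M\<rbrakk> \<Longrightarrow> d (f x y) (f x' y') \<le> d x x' + d y y'"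
  shows "continuous_map (prod_topology mtopology mtopology) mtopology (\<lambda>(x, y). f x y)"
  unfolding continuous_map_to_metric
proof clarsimp
  fix x y and e :: real assume *: "x \<in> M" "y \<in> M" "e > 0"
  \<comment> \<open>The sum bound allots half of \<open>e\<close> to each argument.\<close>
  let ?U = "mball x (e/2) \<times> mball y (e/2)"
  have "f a b \<in> M \<and> d (f x y) (f a b) < e" if "a \<in> mball x (e/2)" "b \<in> mball y (e/2)" for a b
    using le[of x y a b] closed[of a b] that by auto
  moreover have "openin (prod_topology mtopology mtopology) ?U" "(x, y) \<in> ?U"
    using * by (auto simp: openin_prod_Times_iff)
  ultimately show "\<exists>U. openin (prod_topology mtopology mtopology) U \<and> (x, y) \<in> U \<and>
      (\<forall>p\<in>U. f x y \<in> M \<and> (case p of (a, b) \<Rightarrow> f a b) \<in> M \<and> d (f x y) (case p of (a, b) \<Rightarrow> f a b) < e)"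
    using closed * by (intro exI[of _ ?U]) auto
qed

text \<open>The value \<open>s b y\<close> is reached from \<open>s c x\<close> in two moves: first
  the scalar changes at the fixed point \<open>x\<close>, controlled by \<open>lim\<close>, then the
  point changes at the fixed scalar \<open>b\<close>, controlled by \<open>le\<close>, whose
  constant stays bounded while \<open>b\<close> is near \<open>c\<close>.\<close>

lemma continuous_map_scaling:
  assumes closed: "\<And>c x. x \<in> M \<Longrightarrow> s c x \<in> M"
    and le: "\<And>c x y. \<lbrakk>x \<in> M; y \<in> M\<rbrakk> \<Longrightarrow> d (s c x) (s c y) \<le> max 1 \<bar>c\<bar> * d x y"
    and lim: "\<And>c x. x \<in> M \<Longrightarrow> ((\<lambda>b. d (s b x) (s c x)) \<longlongrightarrow> 0) (at c)"
  shows "continuous_map (prod_topology euclideanreal mtopology) mtopology (\<lambda>(c, x). s c x)"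
  unfolding continuous_map_to_metric
proof (clarsimp)
  fix c :: real and x and e :: real assume x: "x \<in> M" and "e > 0"
  then have "\<forall>\<^sub>F b in at c. d (s b x) (s c x) < e/2"
    using order_tendstoD(2)[OF lim[OF x, of c], of "e/2"] by simp
  then obtain \<delta> where "\<delta> > 0" and \<delta>: "\<And>b. b \<noteq> c \<Longrightarrow> dist b c < \<delta> \<Longrightarrow> d (s b x) (s c x) < e/2"
    unfolding eventually_at by blast
  \<comment> \<open>A common bound for \<open>max 1 \<bar>b\<bar>\<close> over all \<open>b\<close>
    within \<open>\<delta>\<close> of \<open>c\<close>.\<close>
  define K where "K = \<bar>c\<bar> + 1 + \<delta>"
  have "K > 0" using \<open>\<delta> > 0\<close> by (simp add: K_def)
  let ?U = "ball c \<delta> \<times> mball x (e / (2 * K))"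
  have "s b y \<in> M \<and> d (s c x) (s b y) < e" if b: "b \<in> ball c \<delta>" and y: "y \<in> mball x (e / (2 * K))" for b y
  proof -
    have "y \<in> M" and "d x y < e / (2 * K)" using y by auto
    \<comment> \<open>The filter \<open>at c\<close> leaves out \<open>c\<close> itself, so
      \<open>b = c\<close> is a separate case, with distance 0.\<close>
    have "d (s c x) (s b x) < e/2"
      using \<delta>[of b] b \<open>e > 0\<close> x closed by (cases "b = c") (auto simp: dist_commute commute)
    moreover have "max 1 \<bar>b\<bar> * d x y \<le> K * d x y"
      using b \<open>\<delta> > 0\<close> by (intro mult_right_mono) (auto simp: K_def dist_real_def)
    moreover have "K * d x y < e/2"
      using \<open>d x y < e / (2 * K)\<close> \<open>K > 0\<close> by (simp add: field_simps)
    ultimately have "d (s c x) (s b y) < e"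
      using le[OF x \<open>y \<in> M\<close>, of b] triangle[of "s c x" "s b x" "s b y"] closed x \<open>y \<in> M\<close> by auto
    with closed \<open>y \<in> M\<close> show ?thesis by blast
  qed
  moreover have "openin (prod_topology euclideanreal mtopology) ?U" "(c, x) \<in> ?U"
    using x \<open>e > 0\<close> \<open>\<delta> > 0\<close> \<open>K > 0\<close> by (auto simp: openin_prod_Times_iff)
  ultimately show "\<exists>U. openin (prod_topology euclideanreal mtopology) U \<and> (c, x) \<in> U \<and>
      (\<forall>p\<in>U. s c x \<in> M \<and> (case p of (b, y) \<Rightarrow> s b y) \<in> M \<and> d (s c x) (case p of (b, y) \<Rightarrow> s b y) < e)"
    using closed[OF x] by (intro exI[of _ ?U]) auto
qed

end

text \<open>Continuous maps into a Hausdorff space that agree on a dense set are equal. Hence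
  exhibiting one continuous \<open>f\<close> with the prescribed values settles both existence and
  uniqueness in the definite description; restricting \<open>f\<close> meets its
  \<open>extensional\<close> clause.\<close>

lemma continuous_extension_eq:
  assumes f: "continuous_map S T f" and fg: "\<And>a. a \<in> A \<Longrightarrow> f (j a) = g a"
    and dense: "S closure_of (j ` A) = topspace S" and T: "Hausdorff_space T"
    and jA: "\<And>a. a \<in> A \<Longrightarrow> j a \<in> topspace S" and p: "p \<in> topspace S"
  shows "continuous_extension S T A j g p = f p"
proof -
  have "continuous_extension S T A j g = restrict f (topspace S)"
    unfolding continuous_extension_def
  proof (rule the_equality)
    show "restrict f (topspace S) \<in> extensional (topspace S) \<and>
        continuous_map S T (restrict f (topspace S)) \<and> (\<forall>a\<in>A. restrict f (topspace S) (j a) = g a)"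
      using f fg jA by (auto intro: continuous_map_eq)
    fix h assume h: "h \<in> extensional (topspace S) \<and> continuous_map S T h \<and> (\<forall>a\<in>A. h (j a) = g a)"
    show "h = restrict f (topspace S)"
    proof (rule extensionalityI)
      show "h \<in> extensional (topspace S)" using h by blast
      fix q assume "q \<in> topspace S"
      moreover have "h x = f x" if "x \<in> j ` A" for x
        using that h fg by auto
      ultimately show "h q = restrict f (topspace S) q"
        using forall_in_closure_of_eq[OF _ T, of q S "j ` A" h f] f h dense by auto
    qed simp
  qed
  with p show ?thesis by simp
qed

section \<open>Completion of a metric vector space\<close>

text \<open>Justifies the choice of representatives in the definitions of \<open>class_add\<close>
  and \<open>class_smult\<close>.\<close>

lemma (in Metric_space) class_representative:
  assumes "P \<in> completion"
  shows "MCauchy (SOME \<sigma>. MCauchy \<sigma> \<and> P = cauchy_class \<sigma>)"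
    and "cauchy_class (SOME \<sigma>. MCauchy \<sigma> \<and> P = cauchy_class \<sigma>) = P"
proof -
  have "\<exists>\<sigma>. MCauchy \<sigma> \<and> P = cauchy_class \<sigma>"
    using assms by (blast elim: completionE)
  from someI_ex[OF this] show "MCauchy (SOME \<sigma>. MCauchy \<sigma> \<and> P = cauchy_class \<sigma>)"
    and "cauchy_class (SOME \<sigma>. MCauchy \<sigma> \<and> P = cauchy_class \<sigma>) = P" by simp_all
qed

section \<open>Real modules with metric estimates for the operations\<close>

lemma real_ring_simps [simp]:
  "carrier real_ring = UNIV" "x \<otimes>\<^bsub>real_ring\<^esub> y = x * y" "\<one>\<^bsub>real_ring\<^esub> = 1"
  "\<zero>\<^bsub>real_ring\<^esub> = 0" "x \<oplus>\<^bsub>real_ring\<^esub> y = x + y"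
  by (simp_all add: real_ring_def)

lemma cring_real_ring: "cring real_ring"
proof (rule cringI)
  show "abelian_group real_ring"
    by (rule abelian_groupI) (auto intro: exI[of _ "- _"])
  show "Group.comm_monoid real_ring"
    by (rule comm_monoidI) auto
qed (auto simp: distrib_right)

text \<open>The estimates are chosen so that they imply \<open>metric_tvs\<close> and are inherited
  by the completion. The locale thus applies to the sequence space and again to its completion. The
  two Lipschitz bounds keep Cauchy sequences Cauchy; the limit condition covers the variation of the
  scalar, about which they say nothing.\<close>

locale metric_real_module = module real_ring V + Metric_space "carrier V" d
  for V :: "(real, 'a) module" (structure) and d +
  assumes dist_add_le: "\<lbrakk>x \<in> carrier V; y \<in> carrier V; x' \<in> carrier V; y' \<in> carrier V\<rbrakk>
      \<Longrightarrow> d (x \<oplus> y) (x' \<oplus> y') \<le> d x x' + d y y'"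
    and dist_smult_le: "\<lbrakk>x \<in> carrier V; y \<in> carrier V\<rbrakk> \<Longrightarrow> d (c \<odot> x) (c \<odot> y) \<le> max 1 \<bar>c\<bar> * d x y"
    and tendsto_smult: "x \<in> carrier V \<Longrightarrow> ((\<lambda>b. d (b \<odot> x) (c \<odot> x)) \<longlongrightarrow> 0) (at c)"
begin

lemma smult_in [simp]: "x \<in> carrier V \<Longrightarrow> c \<odot> x \<in> carrier V"
  by simp

lemma metric_tvs: "metric_tvs V d"
  unfolding metric_tvs_def Let_def
  using module_axioms Metric_space_axioms
    continuous_map_dist_sum_bound[of "(\<oplus>)", OF _ dist_add_le]
    continuous_map_scaling[of "(\<odot>)", OF _ dist_smult_le tendsto_smult]
  by auto

section \<open>Termwise operations on classes of Cauchy sequences\<close>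

lemma MCauchy_add:
  assumes \<sigma>: "MCauchy \<sigma>" and \<tau>: "MCauchy \<tau>"
  shows "MCauchy (\<lambda>n. \<sigma> n \<oplus> \<tau> n)"
proof (rule MCauchyI)
  fix e :: real assume "e > 0"
  then have e: "e/2 > 0" by simp
  obtain N1 where N1: "\<And>m n. m \<ge> N1 \<Longrightarrow> n \<ge> N1 \<Longrightarrow> d (\<sigma> m) (\<sigma> n) < e/2"
    using MCauchyE[OF \<sigma> e] by blast
  obtain N2 where N2: "\<And>m n. m \<ge> N2 \<Longrightarrow> n \<ge> N2 \<Longrightarrow> d (\<tau> m) (\<tau> n) < e/2"
    using MCauchyE[OF \<tau> e] by blast
  have "d (\<sigma> m \<oplus> \<tau> m) (\<sigma> n \<oplus> \<tau> n) < e" if "m \<ge> max N1 N2" "n \<ge> max N1 N2" for m n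
    using dist_add_le[of "\<sigma> m" "\<tau> m" "\<sigma> n" "\<tau> n"] N1[of m n] N2[of m n] that
      MCauchy_in_space[OF \<sigma>] MCauchy_in_space[OF \<tau>] by simp
  then show "\<exists>N. \<forall>m\<ge>N. \<forall>n\<ge>N. d (\<sigma> m \<oplus> \<tau> m) (\<sigma> n \<oplus> \<tau> n) < e" by blast
qed (simp add: MCauchy_in_space assms)

lemma MCauchy_smult:
  assumes \<sigma>: "MCauchy \<sigma>"
  shows "MCauchy (\<lambda>n. c \<odot> \<sigma> n)"
proof (rule MCauchyI)
  fix e :: real assume "e > 0"
  then have "e / max 1 \<bar>c\<bar> > 0" by simp
  from MCauchyE[OF \<sigma> this]
  obtain N where N: "\<And>m n. m \<ge> N \<Longrightarrow> n \<ge> N \<Longrightarrow> d (\<sigma> m) (\<sigma> n) < e / max 1 \<bar>c\<bar>" by blast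
  have "d (c \<odot> \<sigma> m) (c \<odot> \<sigma> n) < e" if "m \<ge> N" "n \<ge> N" for m n
  proof -
    have "d (c \<odot> \<sigma> m) (c \<odot> \<sigma> n) \<le> max 1 \<bar>c\<bar> * d (\<sigma> m) (\<sigma> n)"
      by (intro dist_smult_le MCauchy_in_space \<sigma>)
    also have "\<dots> < e" using N[OF that] by (simp add: pos_less_divide_eq mult.commute)
    finally show ?thesis .
  qed
  then show "\<exists>N. \<forall>m\<ge>N. \<forall>n\<ge>N. d (c \<odot> \<sigma> m) (c \<odot> \<sigma> n) < e" by blast
qed (simp add: MCauchy_in_space assms)

text \<open>A concrete candidate for the continuous extension of the addition, computed on chosen
  representatives. The lemma \<open>class_add\<close> below frees it from the choice.\<close>

definition class_add where
  "class_add P Q = cauchy_class (\<lambda>n. (SOME \<sigma>. MCauchy \<sigma> \<and> P = cauchy_class \<sigma>) n \<oplus>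
     (SOME \<sigma>. MCauchy \<sigma> \<and> Q = cauchy_class \<sigma>) n)"

definition class_smult where
  "class_smult c P = cauchy_class (\<lambda>n. c \<odot> (SOME \<sigma>. MCauchy \<sigma> \<and> P = cauchy_class \<sigma>) n)"

text \<open>By \<open>dist_add_le\<close> the distance between the two sums is squeezed between 0
  and a sum of two null sequences.\<close>

lemma cauchy_class_add_cong:
  assumes C: "MCauchy \<sigma>" "MCauchy \<sigma>'" "MCauchy \<tau>" "MCauchy \<tau>'"
    and eq: "cauchy_class \<sigma> = cauchy_class \<sigma>'" "cauchy_class \<tau> = cauchy_class \<tau>'"
  shows "cauchy_class (\<lambda>n. \<sigma> n \<oplus> \<tau> n) = cauchy_class (\<lambda>n. \<sigma>' n \<oplus> \<tau>' n)"
  unfolding cauchy_class_eq_iff[OF MCauchy_add[OF C(1,3)] MCauchy_add[OF C(2,4)]]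
proof (rule real_tendsto_sandwich[OF _ _ tendsto_const])
  show "(\<lambda>n. d (\<sigma> n) (\<sigma>' n) + d (\<tau> n) (\<tau>' n)) \<longlonglongrightarrow> 0"
    using eq unfolding cauchy_class_eq_iff[OF C(1,2)] cauchy_class_eq_iff[OF C(3,4)]
    using tendsto_add by fastforce
qed (auto simp: dist_add_le MCauchy_in_space C)

lemma cauchy_class_smult_cong:
  assumes C: "MCauchy \<sigma>" "MCauchy \<tau>" and eq: "cauchy_class \<sigma> = cauchy_class \<tau>"
  shows "cauchy_class (\<lambda>n. c \<odot> \<sigma> n) = cauchy_class (\<lambda>n. c \<odot> \<tau> n)"
  unfolding cauchy_class_eq_iff[OF MCauchy_smult[OF C(1)] MCauchy_smult[OF C(2)]]
proof (rule real_tendsto_sandwich[OF _ _ tendsto_const])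
  show "(\<lambda>n. max 1 \<bar>c\<bar> * d (\<sigma> n) (\<tau> n)) \<longlonglongrightarrow> 0"
    using eq unfolding cauchy_class_eq_iff[OF C] by (rule tendsto_mult_right_zero)
qed (auto simp: dist_smult_le MCauchy_in_space C)

lemma class_add:
  assumes "MCauchy \<sigma>" "MCauchy \<tau>"
  shows "class_add (cauchy_class \<sigma>) (cauchy_class \<tau>) = cauchy_class (\<lambda>n. \<sigma> n \<oplus> \<tau> n)"
  unfolding class_add_def
  by (intro cauchy_class_add_cong class_representative assms cauchy_class_in_completion)

lemma class_smult:
  assumes "MCauchy \<sigma>"
  shows "class_smult c (cauchy_class \<sigma>) = cauchy_class (\<lambda>n. c \<odot> \<sigma> n)"
  unfolding class_smult_def
  by (intro cauchy_class_smult_cong class_representative assms cauchy_class_in_completion)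

lemma class_add_closed: "\<lbrakk>P \<in> completion; Q \<in> completion\<rbrakk> \<Longrightarrow> class_add P Q \<in> completion"
  by (auto elim!: completionE simp: class_add intro!: cauchy_class_in_completion MCauchy_add)

lemma class_smult_closed: "P \<in> completion \<Longrightarrow> class_smult c P \<in> completion"
  by (auto elim!: completionE simp: class_smult intro!: cauchy_class_in_completion MCauchy_smult)

lemma class_add_embed:
  "\<lbrakk>x \<in> carrier V; y \<in> carrier V\<rbrakk> \<Longrightarrow>
    class_add (completion_embed (carrier V) d x) (completion_embed (carrier V) d y) =
    completion_embed (carrier V) d (x \<oplus> y)"
  by (simp add: completion_embed_def class_add)

lemma class_smult_embed:
  "x \<in> carrier V \<Longrightarrow>
    class_smult c (completion_embed (carrier V) d x) = completion_embed (carrier V) d (c \<odot> x)"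
  by (simp add: completion_embed_def class_smult)

text \<open>The bound \<open>dist_add_le\<close> holds term by term along representatives and passes
  to the limit.\<close>

lemma completion_dist_add_le:
  assumes "P \<in> completion" "Q \<in> completion" "P' \<in> completion" "Q' \<in> completion"
  shows "cdist (class_add P Q) (class_add P' Q') \<le> cdist P P' + cdist Q Q'"
proof -
  obtain \<sigma> \<tau> \<sigma>' \<tau>' where C: "MCauchy \<sigma>" "MCauchy \<tau>" "MCauchy \<sigma>'" "MCauchy \<tau>'"
    and eq: "P = cauchy_class \<sigma>" "Q = cauchy_class \<tau>" "P' = cauchy_class \<sigma>'" "Q' = cauchy_class \<tau>'"
    using assms by (meson completionE)
  show ?thesis
    unfolding eq class_add[OF C(1,2)] class_add[OF C(3,4)]
  proof (rule LIMSEQ_le)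
    show "(\<lambda>n. d (\<sigma> n \<oplus> \<tau> n) (\<sigma>' n \<oplus> \<tau>' n)) \<longlonglongrightarrow>
        cdist (cauchy_class (\<lambda>n. \<sigma> n \<oplus> \<tau> n)) (cauchy_class (\<lambda>n. \<sigma>' n \<oplus> \<tau>' n))"
      by (intro tendsto_completion_dist MCauchy_add C)
    show "(\<lambda>n. d (\<sigma> n) (\<sigma>' n) + d (\<tau> n) (\<tau>' n)) \<longlonglongrightarrow>
        cdist (cauchy_class \<sigma>) (cauchy_class \<sigma>') + cdist (cauchy_class \<tau>) (cauchy_class \<tau>')"
      by (intro tendsto_add tendsto_completion_dist C)
  qed (use C dist_add_le MCauchy_in_space in blast)
qed

lemma completion_dist_smult_le:
  assumes "P \<in> completion" "Q \<in> completion"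
  shows "cdist (class_smult c P) (class_smult c Q) \<le> max 1 \<bar>c\<bar> * cdist P Q"
proof -
  obtain \<sigma> \<tau> where C: "MCauchy \<sigma>" "MCauchy \<tau>" and eq: "P = cauchy_class \<sigma>" "Q = cauchy_class \<tau>"
    using assms by (meson completionE)
  show ?thesis
    unfolding eq class_smult[OF C(1)] class_smult[OF C(2)]
  proof (rule LIMSEQ_le)
    show "(\<lambda>n. d (c \<odot> \<sigma> n) (c \<odot> \<tau> n)) \<longlonglongrightarrow>
        cdist (cauchy_class (\<lambda>n. c \<odot> \<sigma> n)) (cauchy_class (\<lambda>n. c \<odot> \<tau> n))"
      by (intro tendsto_completion_dist MCauchy_smult C)
    show "(\<lambda>n. max 1 \<bar>c\<bar> * d (\<sigma> n) (\<tau> n)) \<longlonglongrightarrow>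
        max 1 \<bar>c\<bar> * cdist (cauchy_class \<sigma>) (cauchy_class \<tau>)"
      by (intro tendsto_mult tendsto_const tendsto_completion_dist C)
  qed (use C dist_smult_le MCauchy_in_space in blast)
qed

interpretation C: Metric_space completion cdist
  by (rule Metric_space_completion)

text \<open>A three-term estimate: \<open>P\<close> is replaced by the image of a nearby
  \<open>x\<close> in \<open>V\<close>, for which continuity in the scalar is assumed. The two
  replacement errors are controlled by \<open>completion_dist_smult_le\<close>, uniformly for
  scalars near \<open>c\<close>.\<close>

lemma tendsto_class_smult:
  assumes P: "P \<in> completion"
  shows "((\<lambda>b. cdist (class_smult b P) (class_smult c P)) \<longlongrightarrow> 0) (at c)"
proof (rule tendstoI)
  fix e :: real assume "e > 0"
  \<comment> \<open>Scalars \<open>b\<close> within 1 of \<open>c\<close> satisfy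
    \<open>max 1 \<bar>b\<bar> \<le> K\<close>, so approximating \<open>P\<close> within
    \<open>e / (3 * K)\<close> keeps each replacement error below \<open>e/3\<close>.\<close>
  define K where "K = \<bar>c\<bar> + 1"
  have "K > 0" by (simp add: K_def)
  then have e3: "e / (3 * K) > 0" using \<open>e > 0\<close> by simp
  obtain x where x: "x \<in> carrier V" "cdist (completion_embed (carrier V) d x) P < e / (3 * K)"
    using completion_approx[OF P e3] .
  let ?x = "completion_embed (carrier V) d x"
  have x': "?x \<in> completion" using x(1) by (rule completion_embed_in)
  have near: "\<forall>\<^sub>F b in at c. dist b c < 1"
    unfolding eventually_at by (intro exI[of _ 1]) auto
  have lim: "\<forall>\<^sub>F b in at c. d (b \<odot> x) (c \<odot> x) < e/3"
    using order_tendstoD(2)[OF tendsto_smult[OF x(1), of c], of "e/3"] \<open>e > 0\<close> by simp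
  have bound: "cdist (class_smult b P) (class_smult b ?x) < e/3" if "\<bar>b\<bar> \<le> K" for b
  proof -
    have "cdist (class_smult b P) (class_smult b ?x) \<le> max 1 \<bar>b\<bar> * cdist P ?x"
      by (rule completion_dist_smult_le[OF P x'])
    also have "\<dots> \<le> K * cdist P ?x"
      using that by (intro mult_right_mono) (auto simp: K_def)
    also have "\<dots> < e/3"
      using x(2) \<open>K > 0\<close> C.commute[of P ?x] by (simp add: field_simps)
    finally show ?thesis .
  qed
  show "\<forall>\<^sub>F b in at c. dist (cdist (class_smult b P) (class_smult c P)) 0 < e"
    using near lim
  proof eventually_elim
    fix b assume b: "dist b c < 1" "d (b \<odot> x) (c \<odot> x) < e/3"
    have "cdist (class_smult b ?x) (class_smult c ?x) < e/3"
      using b(2) x(1) by (simp add: class_smult_embed completion_dist_embed)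
    moreover have "cdist (class_smult b P) (class_smult b ?x) < e/3"
      using b(1) by (intro bound) (auto simp: K_def dist_real_def)
    moreover have "cdist (class_smult c P) (class_smult c ?x) < e/3"
      by (intro bound) (auto simp: K_def)
    moreover have "\<bar>cdist (class_smult b P) (class_smult c P) - cdist (class_smult b ?x) (class_smult c ?x)\<bar>
        \<le> cdist (class_smult b P) (class_smult b ?x) + cdist (class_smult c P) (class_smult c ?x)"
      by (intro C.dist_diff_le class_smult_closed P x')
    ultimately show "dist (cdist (class_smult b P) (class_smult c P)) 0 < e"
      by (simp add: dist_real_def)
  qed
qed

section \<open>The operations of the completion as continuous extensions\<close>

lemma completion_topology_eq: "completion_topology (carrier V) d = C.mtopology"
  by (simp add: completion_topology_def)

lemma completion_space_simps:
  "carrier (completion_space V d) = completion"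
  "\<zero>\<^bsub>completion_space V d\<^esub> = completion_embed (carrier V) d \<zero>"
  by (simp_all add: completion_space_def Let_def)

text \<open>The map \<open>class_add\<close> is continuous and agrees with the original addition on
  the embedded copy of \<open>V\<close>, so \<open>continuous_extension_eq\<close> identifies it
  with the extension.\<close>

lemma completion_space_add:
  assumes "P \<in> completion" "Q \<in> completion"
  shows "P \<oplus>\<^bsub>completion_space V d\<^esub> Q = class_add P Q"
proof -
  let ?\<iota> = "completion_embed (carrier V) d"
  \<comment> \<open>As the image is a product, its density follows from density in each
    factor.\<close>
  have "(\<lambda>(x, y). (?\<iota> x, ?\<iota> y)) ` (carrier V \<times> carrier V) = ?\<iota> ` carrier V \<times> ?\<iota> ` carrier V"
    by auto
  then have dense: "prod_topology C.mtopology C.mtopology closure_of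
      ((\<lambda>(x, y). (?\<iota> x, ?\<iota> y)) ` (carrier V \<times> carrier V)) =
      topspace (prod_topology C.mtopology C.mtopology)"
    by (simp add: closure_of_Times dense_completion_embed)
  have "continuous_extension (prod_topology C.mtopology C.mtopology) C.mtopology (carrier V \<times> carrier V)
      (\<lambda>(x, y). (?\<iota> x, ?\<iota> y)) (\<lambda>(x, y). ?\<iota> (x \<oplus> y)) (P, Q) = (\<lambda>(P, Q). class_add P Q) (P, Q)"
    by (rule continuous_extension_eq[OF C.continuous_map_dist_sum_bound[OF class_add_closed completion_dist_add_le]
          _ dense C.Hausdorff_space_mtopology])
      (use assms in \<open>auto simp: class_add_embed completion_embed_in\<close>)
  then show ?thesis
    by (simp add: completion_space_def Let_def completion_topology_eq)
qed

lemma completion_space_smult: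
  assumes "P \<in> completion"
  shows "c \<odot>\<^bsub>completion_space V d\<^esub> P = class_smult c P"
proof -
  let ?\<iota> = "completion_embed (carrier V) d"
  \<comment> \<open>Only the vector factor is completed; the scalar factor is already the whole real
    line.\<close>
  have "(\<lambda>(c, x). (c, ?\<iota> x)) ` (UNIV \<times> carrier V) = (UNIV :: real set) \<times> ?\<iota> ` carrier V"
    by auto
  then have dense: "prod_topology euclideanreal C.mtopology closure_of
      ((\<lambda>(c, x). (c, ?\<iota> x)) ` (UNIV \<times> carrier V)) =
      topspace (prod_topology euclideanreal C.mtopology)"
    by (simp add: closure_of_Times dense_completion_embed)
  have "continuous_extension (prod_topology euclideanreal C.mtopology) C.mtopology (UNIV \<times> carrier V)
      (\<lambda>(c, x). (c, ?\<iota> x)) (\<lambda>(c, x). ?\<iota> (c \<odot> x)) (c, P) = (\<lambda>(c, P). class_smult c P) (c, P)"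
    by (rule continuous_extension_eq[OF C.continuous_map_scaling[OF class_smult_closed completion_dist_smult_le tendsto_class_smult]
          _ dense C.Hausdorff_space_mtopology])
      (use assms in \<open>auto simp: class_smult_embed completion_embed_in\<close>)
  then show ?thesis
    by (simp add: completion_space_def Let_def completion_topology_eq)
qed

text \<open>Every module identity holds term by term for representatives, hence for their
  classes.\<close>

lemma module_completion_space: "module real_ring (completion_space V d)"
proof (rule moduleI[OF cring_real_ring], unfold completion_space_simps)
  let ?Y = "completion_space V d"
  note ops = completion_space_add completion_space_smult class_add class_smult
    class_add_closed class_smult_closed MCauchy_add MCauchy_smult
    cauchy_class_in_completion MCauchy_in_space
  have zero: "completion_embed (carrier V) d \<zero> = cauchy_class (\<lambda>_. \<zero>)"
    by (simp add: completion_embed_def)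
  show "abelian_group ?Y"
  proof (rule abelian_groupI, unfold completion_space_simps)
    show "completion_embed (carrier V) d \<zero> \<in> completion" by (rule completion_embed_in) simp
    fix P assume P: "P \<in> completion"
    then obtain \<sigma> where \<sigma>: "MCauchy \<sigma>" "P = cauchy_class \<sigma>" by (rule completionE)
    show "completion_embed (carrier V) d \<zero> \<oplus>\<^bsub>?Y\<^esub> P = P"
      using \<sigma> by (simp add: zero ops)
    \<comment> \<open>The additive inverse of \<open>P\<close> is taken to be
      \<open>class_smult (- 1) P\<close>, whose representative cancels \<open>\<sigma>\<close> term
      by term.\<close>
    have "(- 1) \<odot> x \<oplus> x = \<zero>" if "x \<in> carrier V" for x
      using smult_l_distr[of "-1" 1 x] smult_l_null[OF that] that smult_one[OF that] by simp
    then have "class_smult (- 1) P \<oplus>\<^bsub>?Y\<^esub> P = completion_embed (carrier V) d \<zero>"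
      using \<sigma> by (simp add: zero ops)
    then show "\<exists>Q\<in>completion. Q \<oplus>\<^bsub>?Y\<^esub> P = completion_embed (carrier V) d \<zero>"
      using class_smult_closed[OF P] by blast
    fix Q assume Q: "Q \<in> completion"
    then obtain \<tau> where \<tau>: "MCauchy \<tau>" "Q = cauchy_class \<tau>" by (rule completionE)
    show "P \<oplus>\<^bsub>?Y\<^esub> Q \<in> completion" using P Q by (simp add: ops)
    show "P \<oplus>\<^bsub>?Y\<^esub> Q = Q \<oplus>\<^bsub>?Y\<^esub> P"
      using \<sigma> \<tau> by (simp add: ops a_comm)
    fix R assume R: "R \<in> completion"
    then obtain \<rho> where \<rho>: "MCauchy \<rho>" "R = cauchy_class \<rho>" by (rule completionE)
    show "P \<oplus>\<^bsub>?Y\<^esub> Q \<oplus>\<^bsub>?Y\<^esub> R = P \<oplus>\<^bsub>?Y\<^esub> (Q \<oplus>\<^bsub>?Y\<^esub> R)"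
      using \<sigma> \<tau> \<rho> by (simp add: ops a_assoc)
  qed
  fix b c P assume P: "P \<in> completion"
  then obtain \<sigma> where \<sigma>: "MCauchy \<sigma>" "P = cauchy_class \<sigma>" by (rule completionE)
  show "c \<odot>\<^bsub>?Y\<^esub> P \<in> completion" using P by (simp add: ops)
  show "(b \<oplus>\<^bsub>real_ring\<^esub> c) \<odot>\<^bsub>?Y\<^esub> P = b \<odot>\<^bsub>?Y\<^esub> P \<oplus>\<^bsub>?Y\<^esub> c \<odot>\<^bsub>?Y\<^esub> P"
    using \<sigma> smult_l_distr by (simp add: ops)
  show "(b \<otimes>\<^bsub>real_ring\<^esub> c) \<odot>\<^bsub>?Y\<^esub> P = b \<odot>\<^bsub>?Y\<^esub> (c \<odot>\<^bsub>?Y\<^esub> P)"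
    using \<sigma> smult_assoc1 by (simp add: ops)
  show "\<one>\<^bsub>real_ring\<^esub> \<odot>\<^bsub>?Y\<^esub> P = P"
    using \<sigma> smult_one by (simp add: ops)
  fix Q assume "Q \<in> completion"
  then obtain \<tau> where \<tau>: "MCauchy \<tau>" "Q = cauchy_class \<tau>" by (rule completionE)
  show "c \<odot>\<^bsub>?Y\<^esub> (P \<oplus>\<^bsub>?Y\<^esub> Q) = c \<odot>\<^bsub>?Y\<^esub> P \<oplus>\<^bsub>?Y\<^esub> c \<odot>\<^bsub>?Y\<^esub> Q"
    using \<sigma> \<tau> smult_r_distr by (simp add: ops)
qed

lemma metric_real_module_completion:
  "metric_real_module (completion_space V d) cdist"
  unfolding metric_real_module_def metric_real_module_axioms_def completion_space_simps
  using module_completion_space Metric_space_completion completion_dist_add_le completion_dist_smult_le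
    tendsto_class_smult
  by (simp add: completion_space_add completion_space_smult)

end

section \<open>Finitely supported sequences\<close>

text \<open>Replaces the case distinction by \<open>\<bar>t\<bar>\<close> plus a nonnegative
  multiple of its truncation at \<open>1 / k\<close>. The estimates below then reduce to properties
  of the truncation.\<close>

lemma Phi_eq: "k > 0 \<Longrightarrow> Phi k t = \<bar>t\<bar> + (real k - 1) * min \<bar>t\<bar> (1 / real k)"
  by (auto simp: Phi_def min_def field_simps)

lemma Phi_0 [simp]: "Phi k 0 = 0"
  by (simp add: Phi_def)

lemma Phi_minus [simp]: "Phi k (- t) = Phi k t"
  by (simp add: Phi_def)

lemma Phi_nonneg [simp]: "k > 0 \<Longrightarrow> Phi k t \<ge> 0"
  by (auto simp: Phi_eq)

lemma abs_le_Phi: "k > 0 \<Longrightarrow> \<bar>t\<bar> \<le> Phi k t"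
  by (auto simp: Phi_eq)

lemma Phi_le: "k > 0 \<Longrightarrow> Phi k t \<le> real k * \<bar>t\<bar>"
  using mult_left_mono[of "min \<bar>t\<bar> (1 / real k)" "\<bar>t\<bar>" "real k - 1"]
  by (auto simp: Phi_eq algebra_simps)

text \<open>The truncated absolute value is subadditive, and its factor \<open>k - 1\<close> is
  nonnegative.\<close>

lemma Phi_add_le:
  assumes "k > 0"
  shows "Phi k (s + t) \<le> Phi k s + Phi k t"
proof -
  have "min \<bar>s + t\<bar> (1 / real k) \<le> min \<bar>s\<bar> (1 / real k) + min \<bar>t\<bar> (1 / real k)"
    by (auto simp: min_def intro: order_trans[OF abs_triangle_ineq])
  from mult_left_mono[OF this, of "real k - 1"] show ?thesis
    using assms abs_triangle_ineq[of s t] by (auto simp: Phi_eq algebra_simps)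
qed

text \<open>For \<open>\<bar>c\<bar> < 1\<close> the truncated part need not shrink by the factor
  \<open>\<bar>c\<bar>\<close>, since the level \<open>1 / k\<close> stays fixed; this accounts for
  \<open>max 1 \<bar>c\<bar>\<close>.\<close>

lemma Phi_scale_le:
  assumes "k > 0"
  shows "Phi k (c * t) \<le> max 1 \<bar>c\<bar> * Phi k t"
proof -
  have c: "\<bar>c * t\<bar> \<le> max 1 \<bar>c\<bar> * \<bar>t\<bar>"
    by (simp add: abs_mult mult_right_mono)
  have "1 / real k \<le> max 1 \<bar>c\<bar> * (1 / real k)"
    using mult_right_mono[of 1 "max 1 \<bar>c\<bar>" "1 / real k"] by simp
  with c have "min \<bar>c * t\<bar> (1 / real k) \<le> max 1 \<bar>c\<bar> * min \<bar>t\<bar> (1 / real k)"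
    by (auto simp: min_def)
  from mult_left_mono[OF this, of "real k - 1"] c show ?thesis
    using assms by (auto simp: Phi_eq algebra_simps)
qed

section \<open>The metric vector space of finitely supported sequences\<close>

lemma fin_seq_simps [simp]:
  "carrier fin_seq = {a. finite {n. a n \<noteq> 0}}" "\<zero>\<^bsub>fin_seq\<^esub> = (\<lambda>n. 0)"
  "a \<oplus>\<^bsub>fin_seq\<^esub> b = (\<lambda>n. a n + b n)" "c \<odot>\<^bsub>fin_seq\<^esub> a = (\<lambda>n. c * a n)"
  by (simp_all add: fin_seq_def)

text \<open>The freedom in \<open>S\<close> allows several distances to be written as sums over one
  common index set and compared term by term.\<close>

lemma fin_seq_dist_eq_sum:
  assumes "finite S" "{n. a n \<noteq> b n} \<subseteq> S"
  shows "fin_seq_dist a b = (\<Sum>n\<in>S. Phi (Suc n) (a n - b n))"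
proof -
  have "fin_seq_dist a b = (\<Sum>\<^sub>\<infinity>n\<in>S. Phi (Suc n) (a n - b n))"
    unfolding fin_seq_dist_def
  proof (rule infsum_cong_neutral)
    fix n assume "n \<in> UNIV - S"
    then have "a n = b n" using assms(2) by auto
    then show "Phi (Suc n) (a n - b n) = 0" by simp
  qed auto
  then show ?thesis using assms(1) by simp
qed

lemma Phi_le_fin_seq_dist:
  assumes "a \<in> carrier fin_seq" "b \<in> carrier fin_seq"
  shows "Phi (Suc n) (a n - b n) \<le> fin_seq_dist a b"
proof -
  \<comment> \<open>Inserting \<open>n\<close> makes its term occur in the sum even if both
    sequences vanish there.\<close>
  let ?S = "insert n ({n. a n \<noteq> 0} \<union> {n. b n \<noteq> 0})"
  have "fin_seq_dist a b = (\<Sum>n\<in>?S. Phi (Suc n) (a n - b n))"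
    using assms by (intro fin_seq_dist_eq_sum) auto
  then show ?thesis
    using assms member_le_sum[of n ?S "\<lambda>n. Phi (Suc n) (a n - b n)"] by simp
qed

lemma Metric_space_fin_seq: "Metric_space (carrier fin_seq) fin_seq_dist"
proof
  show "0 \<le> fin_seq_dist a b" for a b
    unfolding fin_seq_dist_def by (rule infsum_nonneg) simp
  show "fin_seq_dist a b = fin_seq_dist b a" for a b
    unfolding fin_seq_dist_def
    by (intro infsum_cong) (metis minus_diff_eq Phi_minus)
next
  fix a b assume ab: "a \<in> carrier fin_seq" "b \<in> carrier fin_seq"
  \<comment> \<open>Each entry difference is bounded by its own term, hence by the whole
    distance.\<close>
  have "a n = b n" if "fin_seq_dist a b = 0" for n
    using Phi_le_fin_seq_dist[OF ab, of n] abs_le_Phi[of "Suc n" "a n - b n"] that by simp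
  then show "fin_seq_dist a b = 0 \<longleftrightarrow> a = b"
    by (auto simp: fin_seq_dist_def)
next
  fix a b c assume abc: "a \<in> carrier fin_seq" "b \<in> carrier fin_seq" "c \<in> carrier fin_seq"
  let ?S = "{n. a n \<noteq> 0} \<union> {n. b n \<noteq> 0} \<union> {n. c n \<noteq> 0}"
  have fin: "finite ?S" using abc by auto
  have "(\<Sum>n\<in>?S. Phi (Suc n) (a n - c n)) \<le> (\<Sum>n\<in>?S. Phi (Suc n) (a n - b n) + Phi (Suc n) (b n - c n))"
  proof (rule sum_mono)
    fix n
    show "Phi (Suc n) (a n - c n) \<le> Phi (Suc n) (a n - b n) + Phi (Suc n) (b n - c n)"
      using Phi_add_le[of "Suc n" "a n - b n" "b n - c n"] by simp
  qed
  then have "(\<Sum>n\<in>?S. Phi (Suc n) (a n - c n)) \<le>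
      (\<Sum>n\<in>?S. Phi (Suc n) (a n - b n)) + (\<Sum>n\<in>?S. Phi (Suc n) (b n - c n))"
    by (simp only: sum.distrib)
  moreover have "fin_seq_dist a c = (\<Sum>n\<in>?S. Phi (Suc n) (a n - c n))"
    "fin_seq_dist a b = (\<Sum>n\<in>?S. Phi (Suc n) (a n - b n))"
    "fin_seq_dist b c = (\<Sum>n\<in>?S. Phi (Suc n) (b n - c n))"
    by (rule fin_seq_dist_eq_sum[OF fin]; auto)+
  ultimately show "fin_seq_dist a c \<le> fin_seq_dist a b + fin_seq_dist b c" by simp
qed

lemma fin_seq_add_closed:
  "\<lbrakk>finite {n. a n \<noteq> (0::real)}; finite {n. b n \<noteq> 0}\<rbrakk> \<Longrightarrow> finite {n. a n + b n \<noteq> 0}"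
  by (rule finite_subset[of _ "{n. a n \<noteq> 0} \<union> {n. b n \<noteq> 0}"]) auto

lemma module_fin_seq: "module real_ring fin_seq"
proof (rule moduleI[OF cring_real_ring])
  show "abelian_group fin_seq"
  proof (rule abelian_groupI)
    fix a assume "a \<in> carrier fin_seq"
    then show "\<exists>b\<in>carrier fin_seq. b \<oplus>\<^bsub>fin_seq\<^esub> a = \<zero>\<^bsub>fin_seq\<^esub>"
      by (intro bexI[of _ "\<lambda>n. - a n"]) auto
  qed (auto intro: fin_seq_add_closed)
qed (auto simp: algebra_simps)

text \<open>The bounds for \<open>Phi\<close> are summed over a common finite index set.\<close>

lemma metric_real_module_fin_seq: "metric_real_module fin_seq fin_seq_dist"
proof (intro metric_real_module.intro metric_real_module_axioms.intro module_fin_seq Metric_space_fin_seq)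
  fix a b a' b' assume c: "a \<in> carrier fin_seq" "b \<in> carrier fin_seq" "a' \<in> carrier fin_seq" "b' \<in> carrier fin_seq"
  let ?S = "({n. a n \<noteq> 0} \<union> {n. b n \<noteq> 0}) \<union> ({n. a' n \<noteq> 0} \<union> {n. b' n \<noteq> 0})"
  have fin: "finite ?S" using c by auto
  have "(\<Sum>n\<in>?S. Phi (Suc n) ((a n + b n) - (a' n + b' n))) \<le>
      (\<Sum>n\<in>?S. Phi (Suc n) (a n - a' n) + Phi (Suc n) (b n - b' n))"
  proof (rule sum_mono)
    fix n
    show "Phi (Suc n) ((a n + b n) - (a' n + b' n)) \<le> Phi (Suc n) (a n - a' n) + Phi (Suc n) (b n - b' n)"
      using Phi_add_le[of "Suc n" "a n - a' n" "b n - b' n"] by (simp add: algebra_simps)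
  qed
  then have "(\<Sum>n\<in>?S. Phi (Suc n) ((a n + b n) - (a' n + b' n))) \<le>
      (\<Sum>n\<in>?S. Phi (Suc n) (a n - a' n)) + (\<Sum>n\<in>?S. Phi (Suc n) (b n - b' n))"
    by (simp only: sum.distrib)
  moreover have "fin_seq_dist (\<lambda>n. a n + b n) (\<lambda>n. a' n + b' n) = (\<Sum>n\<in>?S. Phi (Suc n) ((a n + b n) - (a' n + b' n)))"
    "fin_seq_dist a a' = (\<Sum>n\<in>?S. Phi (Suc n) (a n - a' n))"
    "fin_seq_dist b b' = (\<Sum>n\<in>?S. Phi (Suc n) (b n - b' n))"
    by (rule fin_seq_dist_eq_sum[OF fin]; auto)+
  ultimately show "fin_seq_dist (a \<oplus>\<^bsub>fin_seq\<^esub> b) (a' \<oplus>\<^bsub>fin_seq\<^esub> b') \<le> fin_seq_dist a a' + fin_seq_dist b b'"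
    by simp
next
  fix a b c assume ab: "a \<in> carrier fin_seq" "b \<in> carrier fin_seq"
  let ?S = "{n. a n \<noteq> 0} \<union> {n. b n \<noteq> 0}"
  have fin: "finite ?S" using ab by auto
  have "(\<Sum>n\<in>?S. Phi (Suc n) (c * a n - c * b n)) \<le> (\<Sum>n\<in>?S. max 1 \<bar>c\<bar> * Phi (Suc n) (a n - b n))"
    by (intro sum_mono) (use Phi_scale_le in \<open>simp flip: right_diff_distrib\<close>)
  moreover have "fin_seq_dist (\<lambda>n. c * a n) (\<lambda>n. c * b n) = (\<Sum>n\<in>?S. Phi (Suc n) (c * a n - c * b n))"
    "fin_seq_dist a b = (\<Sum>n\<in>?S. Phi (Suc n) (a n - b n))"
    by (rule fin_seq_dist_eq_sum[OF fin]; auto)+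
  ultimately show "fin_seq_dist (c \<odot>\<^bsub>fin_seq\<^esub> a) (c \<odot>\<^bsub>fin_seq\<^esub> b) \<le> max 1 \<bar>c\<bar> * fin_seq_dist a b"
    by (simp add: sum_distrib_left)
next
  fix a and c :: real assume "a \<in> carrier fin_seq"
  then have fin: "finite {n. a n \<noteq> 0}" by simp
  have eq: "fin_seq_dist (b \<odot>\<^bsub>fin_seq\<^esub> a) (c \<odot>\<^bsub>fin_seq\<^esub> a) = (\<Sum>n | a n \<noteq> 0. Phi (Suc n) (b * a n - c * a n))" for b
    unfolding fin_seq_simps by (rule fin_seq_dist_eq_sum[OF fin]) auto
  \<comment> \<open>Each term is squeezed by the linear bound \<open>Phi_le\<close>. Its constant
    grows with \<open>n\<close>, but the support of \<open>a\<close> is fixed and finite, so the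
    termwise limits add up.\<close>
  have "((\<lambda>b. Phi (Suc n) (b * a n - c * a n)) \<longlongrightarrow> 0) (at c)" for n
  proof (rule real_tendsto_sandwich[OF _ _ tendsto_const])
    have "((\<lambda>b. real (Suc n) * \<bar>b * a n - c * a n\<bar>) \<longlongrightarrow> real (Suc n) * \<bar>c * a n - c * a n\<bar>) (at c)"
      by (intro tendsto_intros)
    then show "((\<lambda>b. real (Suc n) * \<bar>b * a n - c * a n\<bar>) \<longlongrightarrow> 0) (at c)" by simp
  qed (auto intro!: always_eventually Phi_le simp del: of_nat_Suc)
  then show "((\<lambda>b. fin_seq_dist (b \<odot>\<^bsub>fin_seq\<^esub> a) (c \<odot>\<^bsub>fin_seq\<^esub> a)) \<longlongrightarrow> 0) (at c)"
    unfolding eq by (intro tendsto_null_sum)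
qed

section \<open>Failure of the corona property\<close>

text \<open>Only points \<open>z\<close> of the closed ball matter for the corona property. The slack term in \<open>far\<close>, which
  vanishes on that ball, makes the condition stable under limits: a point of the ball of the completion
  need not be a limit of points of the ball of \<open>M\<close>.\<close>

lemma not_corona_propertyI:
  assumes "Metric_space M d" "p \<in> M" "t > 0"
    and far: "\<And>k \<epsilon>. \<lbrakk>0 < k; 0 < \<epsilon>; real k * \<epsilon> \<le> 1\<rbrakk> \<Longrightarrow> \<exists>y\<in>M. d p y \<le> t + \<epsilon> \<and>
      (\<forall>z\<in>M. real k * \<epsilon> \<le> d y z + real k * max 0 (d p z - t))"
  shows "\<not> corona_property M d"
proof
  interpret Metric_space M d by fact
  assume "corona_property M d"
  then obtain C \<epsilon>0 where "C > 0" "\<epsilon>0 > 0"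
    and corona: "\<And>x y \<epsilon>. \<lbrakk>x \<in> M; y \<in> M; 0 \<le> \<epsilon>; \<epsilon> < \<epsilon>0; d x y \<le> t + \<epsilon>\<rbrakk>
      \<Longrightarrow> dist_to_set d y (mcball x t) \<le> C * \<epsilon>"
    unfolding corona_property_def using \<open>t > 0\<close> by meson
  \<comment> \<open>Any \<open>k\<close> beyond the supposed corona constant gives the contradiction
    \<open>k * \<epsilon> \<le> C * \<epsilon>\<close>.\<close>
  obtain k where k: "real k > C" using reals_Archimedean2 by blast
  then have "real k > 0" using \<open>C > 0\<close> by linarith
  then have "k > 0" by simp
  \<comment> \<open>Halving keeps \<open>\<epsilon>\<close> strictly below
    \<open>\<epsilon>0\<close>; the bound \<open>1 / k\<close> is the condition under which
    \<open>far\<close> applies.\<close>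
  define \<epsilon> where "\<epsilon> = min (\<epsilon>0 / 2) (1 / real k)"
  have \<epsilon>: "\<epsilon> > 0" "\<epsilon> < \<epsilon>0" "real k * \<epsilon> \<le> 1"
    using \<open>\<epsilon>0 > 0\<close> \<open>real k > 0\<close> by (auto simp: \<epsilon>_def min_def field_simps)
  obtain y where y: "y \<in> M" "d p y \<le> t + \<epsilon>"
    and far_y: "\<And>z. z \<in> M \<Longrightarrow> real k * \<epsilon> \<le> d y z + real k * max 0 (d p z - t)"
    using far[OF \<open>k > 0\<close> \<epsilon>(1,3)] by blast
  have "real k * \<epsilon> \<le> dist_to_set d y (mcball p t)"
    unfolding dist_to_set_def
  proof (rule cINF_greatest)
    show "mcball p t \<noteq> {}" using \<open>p \<in> M\<close> \<open>t > 0\<close> by force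
    show "real k * \<epsilon> \<le> d y z" if "z \<in> mcball p t" for z
      using far_y[of z] that by auto
  qed
  also have "\<dots> \<le> C * \<epsilon>" using corona[of p y \<epsilon>] y \<epsilon> \<open>p \<in> M\<close> by simp
  finally show False using k \<epsilon>(1) by simp
qed

text \<open>If \<open>z\<close> exceeds the unit ball by \<open>s\<close>, its \<open>k\<close>-th
  entry exceeds \<open>1 / k\<close> by at most \<open>s\<close>. It therefore misses the entry
  \<open>1 / k + \<epsilon>\<close> of \<open>y\<close> by at least \<open>\<epsilon> - s\<close>, a
  gap that \<open>Phi k\<close> magnifies by \<open>k\<close>.\<close>

lemma fin_seq_far:
  assumes "0 < k" "0 < \<epsilon>" "real k * \<epsilon> \<le> 1"
  shows "\<exists>y\<in>carrier fin_seq. fin_seq_dist (\<lambda>n. 0) y \<le> 1 + \<epsilon> \<and>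
    (\<forall>z\<in>carrier fin_seq. real k * \<epsilon> \<le> fin_seq_dist y z + real k * max 0 (fin_seq_dist (\<lambda>n. 0) z - 1))"
proof -
  \<comment> \<open>Positions start at 0, so the entry weighted by \<open>Phi k\<close> sits at
    \<open>m = k - 1\<close>.\<close>
  obtain m where k: "k = Suc m" using assms(1) by (cases k) auto
  define y where "y = (\<lambda>n. if n = m then 1 / real k + \<epsilon> else 0)"
  have y: "y \<in> carrier fin_seq"
    by (auto simp: y_def intro: finite_subset[of _ "{m}"])
  have "fin_seq_dist (\<lambda>n. 0) y = (\<Sum>n\<in>{m}. Phi (Suc n) (0 - y n))"
    by (rule fin_seq_dist_eq_sum) (auto simp: y_def)
  also have "\<dots> = 1 + \<epsilon>"
    using assms(1,2) abs_of_pos[of "1 / real k + \<epsilon>"] Phi_minus[of k "1 / real k + \<epsilon>"]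
    by (simp add: y_def Phi_def add_pos_pos flip: k)
  finally have "fin_seq_dist (\<lambda>n. 0) y = 1 + \<epsilon>" .
  moreover have "real k * \<epsilon> \<le> fin_seq_dist y z + real k * max 0 (fin_seq_dist (\<lambda>n. 0) z - 1)"
    if z: "z \<in> carrier fin_seq" for z
  proof -
    define s where "s = max 0 (fin_seq_dist (\<lambda>n. 0) z - 1)"
    have "Phi k (z m) \<le> 1 + s"
      using Phi_le_fin_seq_dist[of "\<lambda>n. 0" z m] z by (simp add: s_def flip: k)
    \<comment> \<open>Beyond \<open>1 / k\<close> the slope of \<open>Phi k\<close> is 1, so an
      excess \<open>s\<close> in value is an excess of at most \<open>s\<close> in the
      argument.\<close>
    then have "\<bar>z m\<bar> \<le> 1 / real k + s"
      using assms(1) by (auto simp: Phi_def s_def split: if_splits)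
    then have lower: "\<epsilon> - s \<le> \<bar>y m - z m\<bar>" by (simp add: y_def)
    \<comment> \<open>On the steep piece the slope is \<open>k\<close>; past it the value is above
      1, which dominates \<open>k * \<epsilon>\<close>.\<close>
    have "real k * (\<epsilon> - s) \<le> Phi k (y m - z m)"
    proof (cases "\<bar>y m - z m\<bar> \<le> 1 / real k")
      case True
      then show ?thesis using lower assms(1) by (simp add: Phi_def)
    next
      case False
      have "real k * (\<epsilon> - s) \<le> real k * \<epsilon>"
        by (rule mult_left_mono) (auto simp: s_def)
      then show ?thesis using False assms(3) by (simp add: Phi_def)
    qed
    also have "\<dots> \<le> fin_seq_dist y z"
      using Phi_le_fin_seq_dist[OF y z, of m] by (simp flip: k)
    finally show ?thesis by (simp add: s_def algebra_simps)
  qed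
  ultimately show ?thesis using y by (intro bexI[of _ y]) auto
qed

text \<open>The witness is the image of \<open>y\<close>. For a class \<open>R\<close> the
  inequality \<open>far\<close> holds at every term of a representative, whether or not that term
  lies in the ball, and both distances in it converge.\<close>

lemma completion_far:
  assumes "Metric_space M d" "p \<in> M" and y: "y \<in> M" "d p y \<le> t + \<epsilon>"
    and far: "\<And>z. z \<in> M \<Longrightarrow> K * \<epsilon> \<le> d y z + K * max 0 (d p z - t)"
  shows "\<exists>Q\<in>completion_carrier M d. completion_dist M d (completion_embed M d p) Q \<le> t + \<epsilon> \<and>
      (\<forall>R\<in>completion_carrier M d. K * \<epsilon> \<le> completion_dist M d Q R +
        K * max 0 (completion_dist M d (completion_embed M d p) R - t))"
proof -
  interpret Metric_space M d by fact
  have "K * \<epsilon> \<le> cdist (completion_embed M d y) R + K * max 0 (cdist (completion_embed M d p) R - t)"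
    if R: "R \<in> completion" for R
  proof -
    obtain \<sigma> where \<sigma>: "MCauchy \<sigma>" "R = cauchy_class \<sigma>" using R by (rule completionE)
    have "(\<lambda>n. d y (\<sigma> n) + K * max 0 (d p (\<sigma> n) - t)) \<longlonglongrightarrow>
        cdist (completion_embed M d y) R + K * max 0 (cdist (completion_embed M d p) R - t)"
      unfolding \<sigma>(2) by (intro tendsto_intros tendsto_dist_embed \<sigma>(1) y(1) \<open>p \<in> M\<close>)
    then show ?thesis
      by (rule LIMSEQ_le_const) (use far MCauchy_in_space[OF \<sigma>(1)] in blast)
  qed
  then show ?thesis
    using y \<open>p \<in> M\<close> by (intro bexI[of _ "completion_embed M d y"])
      (auto simp: completion_embed_in completion_dist_embed)
qed

theorem theorem6:
  shows "metric_tvs fin_seq fin_seq_dist \<and>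
         \<not> corona_property (carrier fin_seq) fin_seq_dist \<and>
         (let Y = completion_space fin_seq fin_seq_dist;
              D = completion_dist (carrier fin_seq) fin_seq_dist
          in metric_tvs Y D \<and>
             Metric_space.mcomplete (carrier Y) D \<and>
             \<not> corona_property (carrier Y) D)"
proof -
  interpret metric_real_module fin_seq fin_seq_dist
    by (rule metric_real_module_fin_seq)
  have origin: "(\<lambda>n. 0) \<in> carrier fin_seq" by simp
  have "\<not> corona_property (carrier fin_seq) fin_seq_dist"
    by (rule not_corona_propertyI[OF Metric_space_fin_seq origin zero_less_one fin_seq_far])
  \<comment> \<open>The centre is now the image of the zero sequence, again with radius 1; the far
    points are transferred by \<open>completion_far\<close>.\<close>
  moreover have "\<not> corona_property completion cdist"
  proof (rule not_corona_propertyI[OF Metric_space_completion completion_embed_in[OF origin] zero_less_one])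
    fix k :: nat and \<epsilon> :: real assume "0 < k" "0 < \<epsilon>" "real k * \<epsilon> \<le> 1"
    from fin_seq_far[OF this] obtain y where y: "y \<in> carrier fin_seq" "fin_seq_dist (\<lambda>n. 0) y \<le> 1 + \<epsilon>"
      and far: "\<forall>z\<in>carrier fin_seq.
        real k * \<epsilon> \<le> fin_seq_dist y z + real k * max 0 (fin_seq_dist (\<lambda>n. 0) z - 1)"
      by blast
    show "\<exists>Q\<in>completion. cdist (completion_embed (carrier fin_seq) fin_seq_dist (\<lambda>n. 0)) Q \<le> 1 + \<epsilon> \<and>
      (\<forall>R\<in>completion. real k * \<epsilon> \<le> cdist Q R +
        real k * max 0 (cdist (completion_embed (carrier fin_seq) fin_seq_dist (\<lambda>n. 0)) R - 1))"
      by (rule completion_far[OF Metric_space_fin_seq origin y(1)]) (use y(2) far in blast)+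
  qed
  ultimately show ?thesis
    unfolding Let_def completion_space_simps
    using metric_tvs metric_real_module.metric_tvs[OF metric_real_module_completion] mcomplete_completion
    by blast
qed

end
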